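(* Let $\varphi\in\mathrm{Diff}^\infty([0,\infty))$ be an expanding diffeomorphism in Case (2) or Case (3), i.e. either Case (2): for some integer $n\ge 2$, $j^{n-1}\varphi(0)=j^{n-1}\mathrm{id}(0)$ and $\varphi^{(n)}(0)>0$; or Case (3): $j^\infty\varphi(0)=j^\infty\mathrm{id}(0)$. Let $\lambda\in\mathbb{C}$ be any number with $|\lambda|>1$. Then the following hold. 1) Any solution $\beta\in\mathcal{Z}_{\lambda,\varphi}$ on $(0,\infty)$ of the equation $\beta\circ\varphi(x)=\lambda\beta(x)$ extends to $[0,\infty)$ so as to be a smooth function which is flat at $x=0$, i.e. $j^k\beta(0)=0$ for every $k=0,1,2,\dots$. In other words, the space $\mathcal{K}$ of all smooth solutions on $[0,\infty)$ coincides with $\mathcal{Z}_{\lambda,\varphi}$. 2) The same applies to the vector-valued equations: for every $M\ge 2$, any $\boldsymbol\beta\in\mathcal{S}_M$, when extended by $\boldsymbol\beta(0)=0$, is smooth on $[0,\infty)$ and flat at $x=0$.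
   Context: $\varphi$ expanding means $\varphi(0)=0$ and $\varphi(x)-x>0$ for $x>0$. $j^i\varphi(0)$ is the $i$-th jet at $0$ and $\varphi^{(i)}$ the $i$-th derivative. $\mathcal{Z}_{\lambda,\varphi}$ is the complex vector space of $\beta\in C^\infty((0,\infty);\mathbb{C})$ with $\beta(\varphi(x))=\lambda\beta(x)$ for all $x>0$. $\mathcal{K}$ is the space of $\beta\in C^\infty([0,\infty);\mathbb{C})$ with $\beta(\varphi(x))=\lambda\beta(x)$ for all $x\ge0$ (identified with its restriction to $(0,\infty)$). For $M\ge2$, let $A=(a_{ij})$ be the $M\times M$ Jordan block with $a_{ij}=\lambda$ for $i=j$, $a_{ij}=1$ for $i=j+1$, and $a_{ij}=0$ otherwise. $\mathcal{S}_M$ is the space of $\boldsymbol\beta={}^t(\beta_1,\dots,\beta_M)\in C^\infty((0,\infty);\mathbb{C}^M)$ with $\boldsymbol\beta(\varphi(x))=A\boldsymbol\beta(x)$ for all $x>0$; i.e. $\beta_1\circ\varphi=\lambda\beta_1$ and $\beta_m\circ\varphi=\lambda\beta_m+\beta_{m-1}$ for $2\le m\le M$. *)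

theory Defs
  imports "HOL-Analysis.Derivative" "HOL-Library.FuncSet" "Jordan_Normal_Form.Matrix"
begin

text \<open>
  Derivatives are taken within the domain \<open>S\<close>, here \<open>{0<..}\<close> or \<open>{0..}\<close>. At interior points of
  \<open>S\<close> they are the usual ones and at the endpoint of \<open>{0..}\<close> they are one-sided. Neither domain
  has isolated points, so the derivatives are unique, and values of \<open>f\<close> outside \<open>S\<close> play no role.
\<close>

definition nth_deriv_on :: "real set \<Rightarrow> nat \<Rightarrow> (real \<Rightarrow> 'a::real_normed_vector) \<Rightarrow> real \<Rightarrow> 'a" where
  "nth_deriv_on S k f = ((\<lambda>g x. vector_derivative g (at x within S)) ^^ k) f"

definition smooth_on :: "real set \<Rightarrow> (real \<Rightarrow> 'a::real_normed_vector) \<Rightarrow> bool" where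
  "smooth_on S f \<longleftrightarrow> (\<forall>k. \<forall>x\<in>S. nth_deriv_on S k f differentiable (at x within S))"

text \<open>\<open>k = 0\<close> is included, so a flat function vanishes at \<open>0\<close>.\<close>

definition flat_at_0 :: "(real \<Rightarrow> 'a::real_normed_vector) \<Rightarrow> bool" where
  "flat_at_0 f \<longleftrightarrow> (\<forall>k. nth_deriv_on {0..} k f 0 = 0)"

definition diffeo_halfline :: "(real \<Rightarrow> real) \<Rightarrow> bool" where
  "diffeo_halfline \<phi> \<longleftrightarrow>
     bij_betw \<phi> {0..} {0..} \<and> smooth_on {0..} \<phi> \<and> smooth_on {0..} (inv_into {0..} \<phi>)"

definition expanding :: "(real \<Rightarrow> real) \<Rightarrow> bool" where
  "expanding \<phi> \<longleftrightarrow> \<phi> 0 = 0 \<and> (\<forall>x>0. \<phi> x - x > 0)"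

text \<open>Equality of \<open>r\<close>-jets at \<open>0\<close> is equality of all derivatives of order at most \<open>r\<close>.\<close>

definition same_jet :: "nat \<Rightarrow> (real \<Rightarrow> real) \<Rightarrow> (real \<Rightarrow> real) \<Rightarrow> bool" where
  "same_jet r f g \<longleftrightarrow> (\<forall>k\<le>r. nth_deriv_on {0..} k f 0 = nth_deriv_on {0..} k g 0)"

definition case_2 :: "(real \<Rightarrow> real) \<Rightarrow> bool" where
  "case_2 \<phi> \<longleftrightarrow> (\<exists>n\<ge>2. same_jet (n - 1) \<phi> id \<and> nth_deriv_on {0..} n \<phi> 0 > 0)"

definition case_3 :: "(real \<Rightarrow> real) \<Rightarrow> bool" where
  "case_3 \<phi> \<longleftrightarrow> (\<forall>r. same_jet r \<phi> id)"

text \<open>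
  Functions on \<open>(0, \<infinity>)\<close> and on \<open>[0, \<infinity>)\<close> are represented by extensional functions, so that
  elements of the following sets correspond exactly to functions on the half-lines.
\<close>

definition Z_space :: "complex \<Rightarrow> (real \<Rightarrow> real) \<Rightarrow> (real \<Rightarrow> complex) set" where
  "Z_space l \<phi> = {\<beta> \<in> extensional {0<..}. smooth_on {0<..} \<beta> \<and> (\<forall>x>0. \<beta> (\<phi> x) = l * \<beta> x)}"

definition K_space :: "complex \<Rightarrow> (real \<Rightarrow> real) \<Rightarrow> (real \<Rightarrow> complex) set" where
  "K_space l \<phi> = {\<beta> \<in> extensional {0..}. smooth_on {0..} \<beta> \<and> (\<forall>x\<ge>0. \<beta> (\<phi> x) = l * \<beta> x)}"

text \<open>
  The off-diagonal ones are below the diagonal, so this is the transpose of the usual upper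
  triangular Jordan block. Indices run through \<open>0, \<dots>, M - 1\<close>.
\<close>

definition lower_jordan_block :: "nat \<Rightarrow> complex \<Rightarrow> complex mat" where
  "lower_jordan_block M l =
     mat M M (\<lambda>(i, j). if i = j then l else if i = j + 1 then 1 else 0)"

text \<open>
  The type \<open>complex vec\<close> carries no topology; smoothness and flatness of a map into
  \<open>carrier_vec M\<close>, i.e. into \<open>\<complex>\<^sup>M\<close>, are those of its components.
\<close>

definition vec_smooth_on :: "nat \<Rightarrow> real set \<Rightarrow> (real \<Rightarrow> complex vec) \<Rightarrow> bool" where
  "vec_smooth_on M S \<beta> \<longleftrightarrow> (\<forall>i<M. smooth_on S (\<lambda>x. \<beta> x $ i))"

definition vec_flat_at_0 :: "nat \<Rightarrow> (real \<Rightarrow> complex vec) \<Rightarrow> bool" where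
  "vec_flat_at_0 M \<beta> \<longleftrightarrow> (\<forall>i<M. flat_at_0 (\<lambda>x. \<beta> x $ i))"

definition S_space :: "nat \<Rightarrow> complex \<Rightarrow> (real \<Rightarrow> real) \<Rightarrow> (real \<Rightarrow> complex vec) set" where
  "S_space M l \<phi> = {\<beta> \<in> {0<..} \<rightarrow>\<^sub>E carrier_vec M. vec_smooth_on M {0<..} \<beta> \<and>
     (\<forall>x>0. \<beta> (\<phi> x) = lower_jordan_block M l *\<^sub>v \<beta> x)}"

end

theory Submission
  imports Defs
begin

text \<open>
  Both cases give \<open>\<phi>'(0) = 1\<close>, and this is what drives the proof. Near the origin
  \<open>\<phi> x \<le> (1 + \<epsilon>) * x\<close> for every \<open>\<epsilon> > 0\<close>, so an orbit of \<open>\<phi>\<close> that starts at a small \<open>x\<close>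
  needs at least about \<open>ln (1 / x) / ln (1 + \<epsilon>)\<close> steps to reach a fixed distance from the origin. Each step
  multiplies a solution of \<open>\<beta> \<circ> \<phi> = l \<beta>\<close> by \<open>l\<close>, so \<open>\<beta> x\<close> is at most of order
  \<open>x powr (ln \<bar>l\<bar> / ln (1 + \<epsilon>))\<close>, and the exponent is as large as one likes.

  The same argument tolerates a coefficient tending to \<open>1\<close> and an inhomogeneity of order \<open>x\<^sup>N\<close>: if
  \<open>a \<cdot> (g \<circ> \<phi>) = l g + s\<close> with \<open>a \<longlongrightarrow> 1\<close> and \<open>s = O(x\<^sup>N)\<close>, then \<open>g = O(x\<^sup>N)\<close>
  (\<open>bigo_at_0_solution\<close>). This more general equation is stable under differentiation: \<open>g'\<close> solves
  \<open>(a \<phi>') \<cdot> (g' \<circ> \<phi>) = l g' + (s' - a' \<cdot> (g \<circ> \<phi>))\<close>, whose coefficient again tends to \<open>1\<close>.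
  Induction on the order \<open>m\<close> then bounds all derivatives of \<open>g\<close> up to order \<open>m\<close> by \<open>O(x\<^sup>N)\<close>
  (\<open>jet_bigo_solution\<close>): the new inhomogeneity involves derivatives of \<open>g\<close> of order at most \<open>m\<close>
  only, and those are already controlled.

  For a Jordan block, the \<open>i\<close>-th component solves such an equation with \<open>a = 1\<close> whose inhomogeneity is
  the previous component, so induction on \<open>i\<close> applies (\<open>jet_bigo_jordan_solution\<close>).

  Finally, a function on \<open>(0, \<infinity>)\<close> all of whose derivatives are \<open>O(x\<^sup>2)\<close> extends by \<open>0\<close> to a
  smooth function that is flat at \<open>0\<close> (\<open>extension_by_zero_smooth_flat\<close>), so \<open>N = 2\<close> suffices.
\<close>

section \<open>Derivatives within a set\<close>

lemma nth_deriv_on_0 [simp]: "nth_deriv_on S 0 f = f"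
  by (simp add: nth_deriv_on_def)

lemma nth_deriv_on_Suc:
  "nth_deriv_on S (Suc k) f x = vector_derivative (nth_deriv_on S k f) (at x within S)"
  by (simp add: nth_deriv_on_def)

lemma nth_deriv_on_Suc':
  "nth_deriv_on S (Suc k) f = nth_deriv_on S k (\<lambda>x. vector_derivative f (at x within S))"
  by (simp add: nth_deriv_on_def funpow_Suc_right del: funpow.simps)

lemma smooth_on_vector_derivative:
  assumes "smooth_on S f"
  shows "smooth_on S (\<lambda>x. vector_derivative f (at x within S))"
  using assms unfolding smooth_on_def nth_deriv_on_Suc'[symmetric] by blast

lemma smooth_on_has_vector_derivative:
  assumes "smooth_on S f" "x \<in> S"
  shows "(f has_vector_derivative vector_derivative f (at x within S)) (at x within S)"
  using assms unfolding smooth_on_def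
  by (metis nth_deriv_on_0 vector_derivative_works)

lemma smooth_on_imp_continuous_on:
  assumes "smooth_on S f"
  shows "continuous_on S f"
  using smooth_on_has_vector_derivative[OF assms]
  by (meson continuous_on_eq_continuous_within has_vector_derivative_continuous)

lemma at_within_eq_at_if_open_subset:
  assumes "open S" "S \<subseteq> T" "x \<in> S"
  shows "at x within T = at x"
  using assms by (metis at_within_interior interior_maximal subsetD)

lemma at_within_Ici_eq: "0 < x \<Longrightarrow> at x within {0..} = at (x::real)"
  by (rule at_within_eq_at_if_open_subset[of "{0<..}"]) auto

lemma at_within_Ioi_eq: "0 < x \<Longrightarrow> at x within {0<..} = at (x::real)"
  by (rule at_within_eq_at_if_open_subset[of "{0<..}"]) auto

lemma at_0_within_Ici_nontrivial: "at 0 within {0::real..} \<noteq> bot"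
  by (metis at_within_Ici_at_right trivial_limit_at_right_real)

text \<open>
  On an open subset derivatives are local, so they agree with those taken within a larger set. This
  compares derivatives within \<open>{0<..}\<close> and within \<open>{0..}\<close>.
\<close>

lemma nth_deriv_on_open_subset:
  assumes "open S" "S \<subseteq> T" "\<And>x. x \<in> S \<Longrightarrow> f x = g x" "x \<in> S"
  shows "nth_deriv_on S k f x = nth_deriv_on T k g x"
  using \<open>x \<in> S\<close>
proof (induction k arbitrary: x)
  case 0
  then show ?case using assms by simp
next
  case (Suc k)
  have "eventually (\<lambda>y. y \<in> S) (nhds x)"
    using \<open>open S\<close> Suc.prems by (rule eventually_nhds_in_open)
  hence "eventually (\<lambda>y. nth_deriv_on S k f y = nth_deriv_on T k g y) (nhds x)"
    by eventually_elim (rule Suc.IH)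
  hence "vector_derivative (nth_deriv_on S k f) (at x) = vector_derivative (nth_deriv_on T k g) (at x)"
    by (intro vector_derivative_cong_eq) simp_all
  then show ?case
    using at_within_eq_at_if_open_subset[OF \<open>open S\<close> \<open>S \<subseteq> T\<close> Suc.prems]
      at_within_open[OF Suc.prems \<open>open S\<close>]
    by (simp only: nth_deriv_on_Suc)
qed

lemma smooth_on_open_subset:
  assumes "open S" "S \<subseteq> T" "\<And>x. x \<in> S \<Longrightarrow> f x = g x" "smooth_on T g"
  shows "smooth_on S f"
  unfolding smooth_on_def
proof (intro allI ballI)
  fix k x assume "x \<in> S"
  have "nth_deriv_on T k g differentiable (at x within S)"
    using assms(2,4) \<open>x \<in> S\<close> unfolding smooth_on_def
    by (blast intro: differentiable_within_subset)
  thus "nth_deriv_on S k f differentiable (at x within S)"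
  proof (rule differentiable_transform_within)
    show "nth_deriv_on T k g y = nth_deriv_on S k f y" if "y \<in> S" for y
      using nth_deriv_on_open_subset[of S T f g y] assms that by simp
    show "0 < (1::real)" by simp
  qed (rule \<open>x \<in> S\<close>)
qed


section \<open>Derivatives of order \<open>O(x\<^sup>N)\<close> at the origin\<close>

definition bigo_at_0 :: "nat \<Rightarrow> (real \<Rightarrow> 'a::real_normed_vector) \<Rightarrow> bool" where
  "bigo_at_0 N f \<longleftrightarrow> (\<exists>C. eventually (\<lambda>x. norm (f x) \<le> C * x ^ N) (at_right 0))"

text \<open>
  Naming a derivative by an existential quantifier lets closure under sums, products and
  composition be proved by induction on \<open>m\<close>, differentiating once, without formulas for higher derivatives. Large \<open>N\<close> expresses flatness,
  whereas \<open>N = 0\<close> expresses that the derivatives stay bounded.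
\<close>

primrec jet_bigo :: "nat \<Rightarrow> nat \<Rightarrow> (real \<Rightarrow> 'a::real_normed_vector) \<Rightarrow> bool" where
  "jet_bigo N 0 f \<longleftrightarrow> continuous_on {0<..} f \<and> bigo_at_0 N f"
| "jet_bigo N (Suc m) f \<longleftrightarrow> bigo_at_0 N f \<and>
     (\<exists>f'. (\<forall>x>0. (f has_vector_derivative f' x) (at x)) \<and> jet_bigo N m f')"

lemma eventually_at_right_0_pos: "eventually (\<lambda>x::real. 0 < x) (at_right 0)"
  by (rule eventually_at_right_less)

lemma bigo_at_0_scaleR:
  assumes "bigo_at_0 0 a" "bigo_at_0 N f"
  shows "bigo_at_0 N (\<lambda>x. a x *\<^sub>R f x)"
proof -
  from assms obtain A B where "eventually (\<lambda>x. norm (a x) \<le> A) (at_right 0)"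
    "eventually (\<lambda>x. norm (f x) \<le> B * x ^ N) (at_right 0)"
    by (auto simp: bigo_at_0_def)
  hence "eventually (\<lambda>x. norm (a x *\<^sub>R f x) \<le> (A * B) * x ^ N) (at_right 0)"
  proof eventually_elim
    case (elim x)
    have "norm (a x *\<^sub>R f x) = norm (a x) * norm (f x)" by simp
    also have "\<dots> \<le> A * (B * x ^ N)"
      using elim by (intro mult_mono) (auto intro: order_trans[OF norm_ge_zero])
    finally show ?case by (simp add: mult.assoc)
  qed
  thus ?thesis by (auto simp: bigo_at_0_def)
qed

lemma bigo_at_0_add:
  assumes "bigo_at_0 N f" "bigo_at_0 N g"
  shows "bigo_at_0 N (\<lambda>x. f x + g x)"
proof -
  from assms obtain A B where "eventually (\<lambda>x. norm (f x) \<le> A * x ^ N) (at_right 0)"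
    "eventually (\<lambda>x. norm (g x) \<le> B * x ^ N) (at_right 0)"
    by (auto simp: bigo_at_0_def)
  hence "eventually (\<lambda>x. norm (f x + g x) \<le> (A + B) * x ^ N) (at_right 0)"
    by eventually_elim (simp add: distrib_right, meson add_mono norm_triangle_ineq order_trans)
  thus ?thesis by (auto simp: bigo_at_0_def)
qed

lemma bigo_at_0_uminus: "bigo_at_0 N f \<Longrightarrow> bigo_at_0 N (\<lambda>x. - f x)"
  by (simp add: bigo_at_0_def)

lemma bigo_at_0_cong:
  assumes "\<And>x. 0 < x \<Longrightarrow> f x = g x"
  shows "bigo_at_0 N f \<longleftrightarrow> bigo_at_0 N g"
proof -
  have "eventually (\<lambda>x. norm (f x) \<le> C * x ^ N) (at_right 0) \<longleftrightarrow>
        eventually (\<lambda>x. norm (g x) \<le> C * x ^ N) (at_right 0)" for C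
    by (rule eventually_cong[OF eventually_at_right_0_pos]) (simp add: assms)
  thus ?thesis by (simp add: bigo_at_0_def)
qed

lemma jet_bigo_imp_bigo_at_0: "jet_bigo N m f \<Longrightarrow> bigo_at_0 N f"
  by (cases m) auto

lemma jet_bigo_SucI:
  assumes "bigo_at_0 N f" "\<And>x. 0 < x \<Longrightarrow> (f has_vector_derivative f' x) (at x)" "jet_bigo N m f'"
  shows "jet_bigo N (Suc m) f"
  using assms unfolding jet_bigo.simps by blast

lemma jet_bigo_SucE:
  assumes "jet_bigo N (Suc m) f"
  obtains f' where "\<And>x. 0 < x \<Longrightarrow> (f has_vector_derivative f' x) (at x)" "jet_bigo N m f'"
  using assms unfolding jet_bigo.simps by blast

lemma jet_bigo_imp_continuous_on:
  assumes "jet_bigo N m f"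
  shows "continuous_on {0<..} f"
proof (cases m)
  case 0
  then show ?thesis using assms by simp
next
  case (Suc k)
  then obtain f' where f': "\<And>x. 0 < x \<Longrightarrow> (f has_vector_derivative f' x) (at x)"
    using assms jet_bigo_SucE by blast
  show ?thesis
  proof (rule continuous_at_imp_continuous_on, rule ballI)
    show "isCont f x" if "x \<in> {0<..}" for x
      using f'[of x] that has_vector_derivative_continuous by simp
  qed
qed

lemma jet_bigo_Suc_imp: "jet_bigo N (Suc m) f \<Longrightarrow> jet_bigo N m f"
proof (induction m arbitrary: f)
  case 0
  then show ?case using jet_bigo_imp_continuous_on[OF 0] by simp
next
  case (Suc m)
  then show ?case by (metis jet_bigo.simps(2))
qed

lemma jet_bigo_cong:
  assumes "jet_bigo N m f" "\<And>x. 0 < x \<Longrightarrow> f x = g x"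
  shows "jet_bigo N m g"
proof -
  have bigo: "bigo_at_0 N g"
    using jet_bigo_imp_bigo_at_0[OF assms(1)] bigo_at_0_cong[of f g N] assms(2) by simp
  show ?thesis
  proof (cases m)
    case 0
    have "continuous_on {0<..} g"
      using jet_bigo_imp_continuous_on[OF assms(1)] assms(2)
      by (subst continuous_on_cong[OF refl, of _ _ f]) auto
    with bigo 0 show ?thesis by simp
  next
    case (Suc k)
    with assms(1) obtain f' where f': "\<And>x. 0 < x \<Longrightarrow> (f has_vector_derivative f' x) (at x)"
      "jet_bigo N k f'" by auto
    have "(g has_vector_derivative f' x) (at x)" if "0 < x" for x
      using has_vector_derivative_transform_within_open[OF f'(1)[OF that], of "{0<..}" g]
        that assms(2) by auto
    with bigo Suc f'(2) show ?thesis by auto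
  qed
qed

text \<open>Uniqueness of derivatives allows any derivative to replace the one hidden in the definition.\<close>

lemma jet_bigo_derivative:
  assumes "jet_bigo N (Suc m) f" "\<And>x. 0 < x \<Longrightarrow> (f has_vector_derivative f' x) (at x)"
  shows "jet_bigo N m f'"
  using assms by (auto intro: jet_bigo_cong vector_derivative_unique_at)

lemma jet_bigo_zero: "jet_bigo N m (\<lambda>x. 0)"
proof (induction m)
  case 0
  show ?case by (auto simp: bigo_at_0_def intro!: exI[of _ 0])
next
  case (Suc m)
  show ?case
    by (rule jet_bigo_SucI[OF jet_bigo_imp_bigo_at_0[OF Suc.IH] _ Suc.IH]) simp
qed

lemma jet_bigo_const: "jet_bigo 0 m (\<lambda>x. c)"
proof (cases m)
  case 0
  then show ?thesis by (auto simp: bigo_at_0_def)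
next
  case (Suc k)
  have "bigo_at_0 0 (\<lambda>x. c)" by (auto simp: bigo_at_0_def)
  then show ?thesis unfolding Suc by (rule jet_bigo_SucI[OF _ _ jet_bigo_zero]) simp
qed

lemma jet_bigo_add:
  assumes "jet_bigo N m f" "jet_bigo N m g"
  shows "jet_bigo N m (\<lambda>x. f x + g x)"
  using assms
proof (induction m arbitrary: f g)
  case 0
  then show ?case by (simp add: bigo_at_0_add continuous_on_add)
next
  case (Suc m)
  from Suc.prems obtain f' g' where
    "\<And>x. 0 < x \<Longrightarrow> (f has_vector_derivative f' x) (at x)" "jet_bigo N m f'"
    "\<And>x. 0 < x \<Longrightarrow> (g has_vector_derivative g' x) (at x)" "jet_bigo N m g'" by auto
  with Suc show ?case
    by (auto intro!: bigo_at_0_add exI[of _ "\<lambda>x. f' x + g' x"] has_vector_derivative_add)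
qed

lemma jet_bigo_uminus: "jet_bigo N m f \<Longrightarrow> jet_bigo N m (\<lambda>x. - f x)"
proof (induction m arbitrary: f)
  case 0
  then show ?case by (simp add: bigo_at_0_uminus continuous_on_minus)
next
  case (Suc m)
  from Suc.prems obtain f' where
    "\<And>x. 0 < x \<Longrightarrow> (f has_vector_derivative f' x) (at x)" "jet_bigo N m f'" by auto
  with Suc show ?case
    by (auto intro!: bigo_at_0_uminus exI[of _ "\<lambda>x. - f' x"] has_vector_derivative_minus)
qed

text \<open>
  Coefficients enter with exponent \<open>0\<close>: boundedness of their derivatives preserves the order of
  vanishing in every term of the product rule.
\<close>

lemma jet_bigo_scaleR:
  assumes "jet_bigo 0 m a" "jet_bigo N m f"
  shows "jet_bigo N m (\<lambda>x. a x *\<^sub>R f x)"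
  using assms
proof (induction m arbitrary: a f)
  case 0
  then show ?case by (simp add: bigo_at_0_scaleR continuous_on_scaleR)
next
  case (Suc m)
  from Suc.prems obtain a' f' where
    a': "\<And>x. 0 < x \<Longrightarrow> (a has_vector_derivative a' x) (at x)" "jet_bigo 0 m a'" and
    f': "\<And>x. 0 < x \<Longrightarrow> (f has_vector_derivative f' x) (at x)" "jet_bigo N m f'" by auto
  have "((\<lambda>x. a x *\<^sub>R f x) has_vector_derivative (a x *\<^sub>R f' x + a' x *\<^sub>R f x)) (at x)"
    if "0 < x" for x
    using has_vector_derivative_scaleR[of a "a' x" x UNIV f "f' x"] a'(1)[OF that] f'(1)[OF that]
    by (simp add: has_real_derivative_iff_has_vector_derivative)
  moreover have "jet_bigo N m (\<lambda>x. a x *\<^sub>R f' x + a' x *\<^sub>R f x)"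
    by (intro jet_bigo_add Suc.IH a'(2) f'(2) Suc.prems[THEN jet_bigo_Suc_imp])
  moreover have "bigo_at_0 N (\<lambda>x. a x *\<^sub>R f x)"
    using Suc.prems by (auto intro: bigo_at_0_scaleR)
  ultimately show ?case by (intro jet_bigo_SucI)
qed

text \<open>
  Each derivative is continuous at the endpoint \<open>0\<close>, hence bounded near it. This is how the
  smoothness of \<open>\<phi>\<close> up to the boundary is used.
\<close>

lemma smooth_on_Ici_imp_jet_bigo:
  assumes "smooth_on {0..} f"
  shows "jet_bigo 0 m f"
  using assms
proof (induction m arbitrary: f)
  case (0 f)
  have cont: "continuous_on {0..} f" by (rule smooth_on_imp_continuous_on[OF 0])
  hence "(f \<longlongrightarrow> f 0) (at_right 0)"
    by (metis at_within_Ici_at_right atLeast_iff continuous_on_def order_refl)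
  hence "eventually (\<lambda>x. norm (f x) < norm (f 0) + 1) (at_right 0)"
    by (intro order_tendstoD(2)[of _ "norm (f 0)"]) (auto intro: tendsto_norm)
  hence "bigo_at_0 0 f"
    by (auto simp: bigo_at_0_def elim!: eventually_mono intro!: exI[of _ "norm (f 0) + 1"])
  moreover have "continuous_on {0<..} f" by (rule continuous_on_subset[OF cont]) auto
  ultimately show ?case by simp
next
  case (Suc m f)
  define f' where "f' = (\<lambda>x. vector_derivative f (at x within {0..}))"
  have "jet_bigo 0 m f" "jet_bigo 0 m f'"
    using Suc.IH Suc.prems smooth_on_vector_derivative unfolding f'_def by blast+
  moreover have "(f has_vector_derivative f' x) (at x)" if "0 < x" for x
    using smooth_on_has_vector_derivative[OF Suc.prems, of x] that
    by (simp add: f'_def at_within_Ici_eq)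
  ultimately show ?case by (auto dest: jet_bigo_imp_bigo_at_0)
qed

section \<open>Extension by zero\<close>

lemma bigo_at_0_imp_derivative_0:
  assumes "bigo_at_0 2 f" "f 0 = 0"
  shows "(f has_vector_derivative 0) (at 0 within {0..})"
proof -
  obtain C where C: "eventually (\<lambda>x. norm (f x) \<le> C * x\<^sup>2) (at_right 0)"
    using assms by (auto simp: bigo_at_0_def)
  have "((\<lambda>x. norm (f x) / norm x) \<longlongrightarrow> 0) (at_right 0)"
  proof (rule Lim_null_comparison)
    show "eventually (\<lambda>x. norm (norm (f x) / norm x) \<le> C * x) (at_right 0)"
      using C eventually_at_right_0_pos
      by eventually_elim (simp add: field_simps power2_eq_square)
    show "((\<lambda>x. C * x) \<longlongrightarrow> 0) (at_right 0)"
      by (auto intro!: tendsto_eq_intros)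
  qed
  thus ?thesis
    using assms(2)
    by (simp add: has_vector_derivative_def has_derivative_iff_norm at_within_Ici_at_right)
qed

text \<open>
  Both hypotheses pass from \<open>f\<close> to its derivative within \<open>{0..}\<close>: off the origin this is the usual
  derivative, and at the origin it is \<open>0\<close> because \<open>f = O(x\<^sup>2)\<close>. Iterating gives the claim.
\<close>

lemma extension_by_zero_smooth_flat:
  assumes "\<And>m. jet_bigo 2 m f" "f 0 = 0"
  shows "smooth_on {0..} f \<and> flat_at_0 f"
proof -
  have deriv_0: "(h has_vector_derivative 0) (at 0 within {0..})"
    if "\<And>m. jet_bigo 2 m h" "h 0 = 0" for h :: "real \<Rightarrow> 'a"
    using that jet_bigo_imp_bigo_at_0 bigo_at_0_imp_derivative_0 by blast
  have deriv_pos: "(h has_vector_derivative vector_derivative h (at x within {0..})) (at x)"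
    if "\<And>m. jet_bigo 2 m h" "0 < x" for h :: "real \<Rightarrow> 'a" and x
  proof -
    from that(1)[of "Suc 0"] obtain h' where "(h has_vector_derivative h' x) (at x)"
      using \<open>0 < x\<close> by auto
    with \<open>0 < x\<close> show ?thesis
      by (simp add: at_within_Ici_eq vector_derivative_at)
  qed
  have main: "(\<forall>m. jet_bigo 2 m (nth_deriv_on {0..} k f)) \<and> nth_deriv_on {0..} k f 0 = 0" for k
  proof (induction k)
    case 0
    then show ?case using assms by simp
  next
    case (Suc k)
    have "jet_bigo 2 m (nth_deriv_on {0..} (Suc k) f)" for m
      by (rule jet_bigo_derivative[of _ _ "nth_deriv_on {0..} k f"])
         (use Suc in \<open>auto simp only: nth_deriv_on_Suc intro: deriv_pos\<close>)
    moreover have "nth_deriv_on {0..} (Suc k) f 0 = 0"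
      using deriv_0 Suc at_0_within_Ici_nontrivial
      by (simp add: nth_deriv_on_Suc vector_derivative_within)
    ultimately show ?case by blast
  qed
  have "nth_deriv_on {0..} k f differentiable (at x within {0..})" if "0 \<le> x" for k x
  proof (cases "x = 0")
    case True
    then show ?thesis using deriv_0 main differentiableI_vector by blast
  next
    case False
    with that have "0 < x" by simp
    with deriv_pos main show ?thesis
      by (metis at_within_Ici_eq differentiableI_vector)
  qed
  with main show ?thesis by (simp add: smooth_on_def flat_at_0_def)
qed


section \<open>The functional equation near the fixed point\<close>

text \<open>
  Iterating the inequality along an orbit is avoided by a maximum argument. The quotient
  \<open>h x = norm (g x) / x ^ N\<close> satisfies \<open>h x \<le> r * h (\<phi> x) + B\<close> near the origin for some \<open>r < 1\<close>,
  since \<open>\<phi> x / x \<longlongrightarrow> 1\<close> makes the factor \<open>(\<phi> x / x) ^ N\<close> harmless. Where \<open>h\<close> attains its maximum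
  over \<open>[x, 2 d]\<close>, either the point lies in the fixed compact interval \<open>[d, 2 d]\<close>, or its image under
  \<open>\<phi>\<close> is still in \<open>[x, 2 d]\<close> and the inequality bounds the maximum by \<open>B / (1 - r)\<close>. Neither bound
  depends on \<open>x\<close>.
\<close>

lemma bigo_at_0_if_contracting_along_orbits:
  fixes \<phi> q :: "real \<Rightarrow> real"
  assumes cont: "continuous_on {0<..} g"
    and incr: "\<And>x. 0 < x \<Longrightarrow> x \<le> \<phi> x"
    and tangent: "((\<lambda>x. \<phi> x / x) \<longlongrightarrow> 1) (at_right 0)"
    and q: "(q \<longlongrightarrow> c) (at_right 0)" "0 \<le> c" "c < 1"
    and ineq: "eventually (\<lambda>x. norm (g x) \<le> q x * norm (g (\<phi> x)) + B * x ^ N) (at_right 0)"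
  shows "bigo_at_0 N g"
proof -
  \<comment> \<open>Any number strictly between \<open>c\<close> and \<open>1\<close> would do.\<close>
  define r where "r = (c + 1) / 2"
  have r: "c < r" "0 \<le> r" "r < 1" using q by (auto simp: r_def)
  have "((\<lambda>x. q x * (\<phi> x / x) ^ N) \<longlongrightarrow> c * 1 ^ N) (at_right 0)"
    by (intro tendsto_intros q tangent)
  hence "eventually (\<lambda>x. q x * (\<phi> x / x) ^ N < r) (at_right 0)"
    using r by (intro order_tendstoD) auto
  moreover have "eventually (\<lambda>x. \<phi> x / x < 2) (at_right 0)"
    using tangent by (rule order_tendstoD) auto
  ultimately have "eventually (\<lambda>x. q x * (\<phi> x / x) ^ N < r \<and> \<phi> x / x < 2 \<and>
      norm (g x) \<le> q x * norm (g (\<phi> x)) + B * x ^ N) (at_right 0)"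
    using ineq by eventually_elim simp
  then obtain d where d: "0 < d" and near: "\<And>x. 0 < x \<Longrightarrow> x < d \<Longrightarrow> q x * (\<phi> x / x) ^ N < r"
    "\<And>x. 0 < x \<Longrightarrow> x < d \<Longrightarrow> \<phi> x / x < 2"
    "\<And>x. 0 < x \<Longrightarrow> x < d \<Longrightarrow> norm (g x) \<le> q x * norm (g (\<phi> x)) + B * x ^ N"
    unfolding eventually_at_right_field by blast
  define h where "h = (\<lambda>x. norm (g x) / x ^ N)"
  have cont_h: "continuous_on {0<..} h"
    unfolding h_def by (intro continuous_intros cont) auto
  have h_step: "h x \<le> r * h (\<phi> x) + B" if "0 < x" "x < d" for x
  proof -
    have pos: "0 < \<phi> x" using incr[OF that(1)] that(1) by linarith
    have "h x \<le> (q x * norm (g (\<phi> x)) + B * x ^ N) / x ^ N"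
      unfolding h_def using near(3)[OF that] that(1) by (intro divide_right_mono) auto
    also have "\<dots> = (q x * (\<phi> x / x) ^ N) * h (\<phi> x) + B"
      using that(1) pos by (simp add: h_def field_simps)
    also have "\<dots> \<le> r * h (\<phi> x) + B"
      using near(1)[OF that] pos by (intro add_right_mono mult_right_mono) (auto simp: h_def)
    finally show ?thesis .
  qed
  obtain H where H: "\<And>y. y \<in> {d..2*d} \<Longrightarrow> h y \<le> H"
    using continuous_attains_sup[of "{d..2*d}" h] continuous_on_subset[OF cont_h, of "{d..2*d}"] d
    by fastforce
  have bound: "h x \<le> max H (B / (1 - r))" if x: "0 < x" "x < d" for x
  proof -
    obtain y where y: "y \<in> {x..2*d}" and max: "\<And>z. z \<in> {x..2*d} \<Longrightarrow> h z \<le> h y"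
      using continuous_attains_sup[of "{x..2*d}" h] continuous_on_subset[OF cont_h, of "{x..2*d}"] x d
      by fastforce
    have "h y \<le> max H (B / (1 - r))"
    proof (cases "d \<le> y")
      case True
      then show ?thesis using H[of y] y by auto
    next
      case False
      hence y': "0 < y" "y < d" using x y by auto
      hence "y \<le> \<phi> y" "\<phi> y < 2 * y"
        using incr near(2)[OF y'] by (auto simp: field_simps)
      hence "h (\<phi> y) \<le> h y" using y y' by (intro max) auto
      hence "h y \<le> r * h y + B"
        using h_step[OF y'] mult_left_mono[of "h (\<phi> y)" "h y" r] r by linarith
      hence "h y \<le> B / (1 - r)" using r by (simp add: field_simps)
      thus ?thesis by simp
    qed
    with max[of x] x d show ?thesis by fastforce
  qed
  have "eventually (\<lambda>x. norm (g x) \<le> max H (B / (1 - r)) * x ^ N) (at_right 0)"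
    unfolding eventually_at_right_field
    using d bound by (intro exI[of _ d]) (auto simp: h_def pos_divide_le_eq)
  thus ?thesis unfolding bigo_at_0_def by blast
qed

text \<open>
  The behaviour of \<open>\<phi>\<close> on \<open>(0, \<infinity>)\<close> and near the origin on which the estimates rest; here \<open>\<phi>'\<close>
  is the derivative of \<open>\<phi>\<close>. The last two assumptions both express that the derivative at \<open>0\<close> is \<open>1\<close>.
\<close>

locale expansion_tangent_to_id =
  fixes \<phi> \<phi>' :: "real \<Rightarrow> real"
  assumes expanding: "\<And>x. 0 < x \<Longrightarrow> x < \<phi> x"
    and deriv: "\<And>x. 0 < x \<Longrightarrow> (\<phi> has_real_derivative \<phi>' x) (at x)"
    and jet_deriv: "\<And>m. jet_bigo 0 m \<phi>'"
    and deriv_tendsto: "(\<phi>' \<longlongrightarrow> 1) (at_right 0)"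
    and quotient_tendsto: "((\<lambda>x. \<phi> x / x) \<longlongrightarrow> 1) (at_right 0)"
begin

lemma positive: "0 < x \<Longrightarrow> 0 < \<phi> x"
  using expanding less_trans by blast

lemma continuous: "continuous_on {0<..} \<phi>"
  by (auto intro!: continuous_at_imp_continuous_on DERIV_isCont deriv)

lemma filterlim_at_right_0: "filterlim \<phi> (at_right 0) (at_right 0)"
proof -
  have "((\<lambda>x. \<phi> x / x * x) \<longlongrightarrow> 1 * 0) (at_right 0)"
    by (intro tendsto_mult quotient_tendsto tendsto_ident_at)
  moreover have "eventually (\<lambda>x. \<phi> x / x * x = \<phi> x) (at_right 0)"
    using eventually_at_right_0_pos by eventually_elim simp
  ultimately have "(\<phi> \<longlongrightarrow> 0) (at_right 0)"
    by (simp add: tendsto_cong)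
  moreover have "eventually (\<lambda>x. \<phi> x \<in> {0<..}) (at_right 0)"
    using eventually_at_right_0_pos by eventually_elim (simp add: positive)
  ultimately show ?thesis
    by (auto simp: filterlim_at elim: eventually_mono)
qed

text \<open>Near the origin \<open>\<phi> x < 2 * x\<close>, so composition with \<open>\<phi>\<close> costs at most a factor \<open>2 ^ N\<close>.\<close>

lemma bigo_at_0_compose:
  assumes "bigo_at_0 N g"
  shows "bigo_at_0 N (\<lambda>x. g (\<phi> x))"
proof -
  obtain C where "eventually (\<lambda>x. norm (g x) \<le> C * x ^ N) (at_right 0)"
    using assms by (auto simp: bigo_at_0_def)
  hence "eventually (\<lambda>x. norm (g (\<phi> x)) \<le> C * \<phi> x ^ N) (at_right 0)"
    by (rule eventually_compose_filterlim[OF _ filterlim_at_right_0])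
  moreover have "eventually (\<lambda>x. \<phi> x / x < 2) (at_right 0)"
    using quotient_tendsto by (rule order_tendstoD) auto
  ultimately have "eventually (\<lambda>x. norm (g (\<phi> x)) \<le> (\<bar>C\<bar> * 2 ^ N) * x ^ N) (at_right 0)"
    using eventually_at_right_0_pos
  proof eventually_elim
    case (elim x)
    have "norm (g (\<phi> x)) \<le> \<bar>C\<bar> * \<phi> x ^ N"
      using elim(1) positive[OF elim(3)] by (meson abs_ge_self less_imp_le mult_right_mono order_trans zero_le_power)
    also have "\<dots> \<le> \<bar>C\<bar> * (2 * x) ^ N"
      using elim(2,3) positive[OF elim(3)] 
      by (intro mult_left_mono power_mono) (auto simp: field_simps)
    finally show ?case by (simp add: power_mult_distrib mult.assoc)
  qed
  thus ?thesis unfolding bigo_at_0_def by blast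
qed

lemma jet_bigo_compose:
  assumes "jet_bigo N m g"
  shows "jet_bigo N m (\<lambda>x. g (\<phi> x))"
  using assms
proof (induction m arbitrary: g)
  case 0
  have "continuous_on {0<..} (\<lambda>x. g (\<phi> x))"
    using 0 by (intro continuous_on_compose2[OF _ continuous]) (auto simp: positive)
  with 0 show ?case by (simp add: bigo_at_0_compose)
next
  case (Suc m)
  from Suc.prems obtain g' where
    g': "\<And>x. 0 < x \<Longrightarrow> (g has_vector_derivative g' x) (at x)" "jet_bigo N m g'" by auto
  have "((\<lambda>x. g (\<phi> x)) has_vector_derivative \<phi>' x *\<^sub>R g' (\<phi> x)) (at x)" if "0 < x" for x
    using vector_diff_chain_at[of \<phi> "\<phi>' x" x g "g' (\<phi> x)"] deriv[OF that] g'(1)[OF positive[OF that]]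
    by (simp add: o_def has_real_derivative_iff_has_vector_derivative)
  moreover have "jet_bigo N m (\<lambda>x. \<phi>' x *\<^sub>R g' (\<phi> x))"
    by (intro jet_bigo_scaleR jet_deriv Suc.IH g')
  moreover have "bigo_at_0 N (\<lambda>x. g (\<phi> x))"
    using Suc.prems by (simp add: bigo_at_0_compose)
  ultimately show ?case by (intro jet_bigo_SucI)
qed

text \<open>
  Solving the equation for \<open>g x\<close> gives a contraction with factor \<open>\<bar>a x\<bar> / \<bar>l\<bar>\<close>, which tends to
  \<open>1 / \<bar>l\<bar> < 1\<close>.
\<close>

lemma bigo_at_0_solution:
  fixes g s :: "real \<Rightarrow> complex"
  assumes "1 < cmod l" "continuous_on {0<..} g" "(a \<longlongrightarrow> 1) (at_right 0)" "bigo_at_0 N s"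
    and eq: "\<And>x. 0 < x \<Longrightarrow> a x *\<^sub>R g (\<phi> x) = l * g x + s x"
  shows "bigo_at_0 N g"
proof -
  obtain C where C: "eventually (\<lambda>x. cmod (s x) \<le> C * x ^ N) (at_right 0)"
    using assms(4) by (auto simp: bigo_at_0_def)
  show ?thesis
  proof (rule bigo_at_0_if_contracting_along_orbits[of g \<phi> "\<lambda>x. \<bar>a x\<bar> / cmod l" "1 / cmod l"])
    show "((\<lambda>x. \<bar>a x\<bar> / cmod l) \<longlongrightarrow> 1 / cmod l) (at_right 0)"
      using assms(1) by (auto intro!: tendsto_eq_intros assms(3))
    show "eventually (\<lambda>x. cmod (g x) \<le> \<bar>a x\<bar> / cmod l * cmod (g (\<phi> x)) + C / cmod l * x ^ N) (at_right 0)"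
      using C eventually_at_right_0_pos
    proof eventually_elim
      case (elim x)
      have "cmod l * cmod (g x) = cmod (a x *\<^sub>R g (\<phi> x) - s x)"
        by (simp add: eq[OF elim(2)] norm_mult)
      also have "\<dots> \<le> \<bar>a x\<bar> * cmod (g (\<phi> x)) + C * x ^ N"
        using norm_triangle_ineq4[of "a x *\<^sub>R g (\<phi> x)" "s x"] elim(1) by simp
      finally have "cmod (g x) \<le> (\<bar>a x\<bar> * cmod (g (\<phi> x)) + C * x ^ N) / cmod l"
        using assms(1) by (subst pos_le_divide_eq) (linarith, simp only: mult.commute)
      thus ?case by (simp add: add_divide_distrib)
    qed
    show "1 / cmod l < 1" using assms(1) by (subst divide_less_eq_1) auto
  qed (use assms expanding quotient_tendsto in \<open>auto intro: less_imp_le\<close>)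
qed

text \<open>
  The induction runs over all equations of this form at once, since differentiating changes the
  coefficient and the inhomogeneity. The induction hypothesis is used twice: for \<open>g\<close> itself, so that
  \<open>a' \<cdot> (g \<circ> \<phi>)\<close> is a legitimate inhomogeneity, and then for the equation solved by \<open>g'\<close>.
\<close>

lemma jet_bigo_solution:
  fixes g s :: "real \<Rightarrow> complex"
  assumes "1 < cmod l" "smooth_on {0<..} g" "jet_bigo 0 m a" "(a \<longlongrightarrow> 1) (at_right 0)"
    "jet_bigo N m s" "\<And>x. 0 < x \<Longrightarrow> a x *\<^sub>R g (\<phi> x) = l * g x + s x"
  shows "jet_bigo N m g"
  using assms(2-)
proof (induction m arbitrary: g a s)
  case (0 g a s)
  moreover have "continuous_on {0<..} g" by (rule smooth_on_imp_continuous_on[OF 0(1)])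
  ultimately show ?case
    using bigo_at_0_solution[OF assms(1), of g a N s] by simp
next
  case (Suc m g a s)
  define g' where "g' = (\<lambda>x. vector_derivative g (at x within {0<..}))"
  have g': "(g has_vector_derivative g' x) (at x)" if "0 < x" for x
    using smooth_on_has_vector_derivative[OF Suc.prems(1), of x] that
    by (simp add: g'_def at_within_Ioi_eq)
  from Suc.prems(2) obtain a' where
    a': "\<And>x. 0 < x \<Longrightarrow> (a has_vector_derivative a' x) (at x)" "jet_bigo 0 m a'" by auto
  from Suc.prems(4) obtain s' where
    s': "\<And>x. 0 < x \<Longrightarrow> (s has_vector_derivative s' x) (at x)" "jet_bigo N m s'" by auto
  have a_m: "jet_bigo 0 m a" and s_m: "jet_bigo N m s"
    using Suc.prems jet_bigo_Suc_imp by blast+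
  have g_m: "jet_bigo N m g"
    using Suc.IH[OF Suc.prems(1) a_m Suc.prems(3) s_m Suc.prems(5)] .
  have "jet_bigo N m g'"
  proof (rule Suc.IH)
    show "smooth_on {0<..} g'"
      unfolding g'_def by (rule smooth_on_vector_derivative[OF Suc.prems(1)])
    show "jet_bigo 0 m (\<lambda>x. a x *\<^sub>R \<phi>' x)"
      by (rule jet_bigo_scaleR[OF a_m jet_deriv])
    show "((\<lambda>x. a x *\<^sub>R \<phi>' x) \<longlongrightarrow> 1) (at_right 0)"
      using tendsto_mult[OF Suc.prems(3) deriv_tendsto] by simp
    show "jet_bigo N m (\<lambda>x. s' x + - (a' x *\<^sub>R g (\<phi> x)))"
      by (intro jet_bigo_add jet_bigo_uminus jet_bigo_scaleR jet_bigo_compose a' s' g_m)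
    show "(a x *\<^sub>R \<phi>' x) *\<^sub>R g' (\<phi> x) = l * g' x + (s' x + - (a' x *\<^sub>R g (\<phi> x)))" if x: "0 < x" for x
    proof -
      have "((\<lambda>x. g (\<phi> x)) has_vector_derivative \<phi>' x *\<^sub>R g' (\<phi> x)) (at x)"
        using vector_diff_chain_at[of \<phi> "\<phi>' x" x g "g' (\<phi> x)"] deriv[OF x] g'[OF positive[OF x]]
        by (simp add: o_def has_real_derivative_iff_has_vector_derivative)
      hence "((\<lambda>x. a x *\<^sub>R g (\<phi> x)) has_vector_derivative
          (a x *\<^sub>R (\<phi>' x *\<^sub>R g' (\<phi> x)) + a' x *\<^sub>R g (\<phi> x))) (at x)"
        using has_vector_derivative_scaleR[of a "a' x" x UNIV] a'(1)[OF x]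
        by (simp add: has_real_derivative_iff_has_vector_derivative del: scaleR_scaleR)
      moreover have "((\<lambda>x. l * g x + s x) has_vector_derivative (l * g' x + s' x)) (at x)"
        by (intro has_vector_derivative_add has_vector_derivative_mult_right g' s' x)
      hence "((\<lambda>x. a x *\<^sub>R g (\<phi> x)) has_vector_derivative (l * g' x + s' x)) (at x)"
        by (rule has_vector_derivative_transform_within_open[of _ _ _ "{0<..}"])
           (use x Suc.prems(5) in auto)
      ultimately have "a x *\<^sub>R (\<phi>' x *\<^sub>R g' (\<phi> x)) + a' x *\<^sub>R g (\<phi> x) = l * g' x + s' x"
        by (rule vector_derivative_unique_at)
      thus ?thesis by (simp add: algebra_simps)
    qed
  qed
  with g' g_m show ?case by (auto dest: jet_bigo_imp_bigo_at_0)
qed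

end

section \<open>Expanding diffeomorphisms and Jordan blocks\<close>

lemma same_jet_imp_deriv_0:
  assumes "same_jet r \<phi> id" "1 \<le> r"
  shows "vector_derivative \<phi> (at 0 within {0..}) = 1"
proof -
  have "vector_derivative \<phi> (at 0 within {0..}) = vector_derivative id (at (0::real) within {0..})"
    using assms by (simp add: same_jet_def nth_deriv_on_def) (metis (no_types, lifting) One_nat_def funpow_0 funpow.simps(2) o_apply)
  also have "\<dots> = 1"
    using has_vector_derivative_id at_0_within_Ici_nontrivial
    by (intro vector_derivative_within) (auto simp: id_def)
  finally show ?thesis .
qed

lemma expansion_tangent_to_id_if_smooth:
  assumes smooth: "smooth_on {0..} \<phi>" and "expanding \<phi>"
    and deriv_0: "vector_derivative \<phi> (at 0 within {0..}) = 1"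
  shows "expansion_tangent_to_id \<phi> (\<lambda>x. vector_derivative \<phi> (at x within {0..}))"
proof
  show "x < \<phi> x" if "0 < x" for x
    using that \<open>expanding \<phi>\<close> unfolding expanding_def by force
  show "(\<phi> has_real_derivative vector_derivative \<phi> (at x within {0..})) (at x)" if "0 < x" for x
    using smooth_on_has_vector_derivative[OF smooth, of x] that
    by (simp add: at_within_Ici_eq has_real_derivative_iff_has_vector_derivative)
  have smooth': "smooth_on {0..} (\<lambda>x. vector_derivative \<phi> (at x within {0..}))"
    by (rule smooth_on_vector_derivative[OF smooth])
  show "jet_bigo 0 m (\<lambda>x. vector_derivative \<phi> (at x within {0..}))" for m
    by (rule smooth_on_Ici_imp_jet_bigo[OF smooth'])
  have "((\<lambda>x. vector_derivative \<phi> (at x within {0..})) \<longlongrightarrow>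
      vector_derivative \<phi> (at 0 within {0..})) (at 0 within {0..})"
    using smooth_on_imp_continuous_on[OF smooth'] unfolding continuous_on_def by blast
  thus "((\<lambda>x. vector_derivative \<phi> (at x within {0..})) \<longlongrightarrow> 1) (at_right 0)"
    unfolding deriv_0 unfolding at_within_Ici_at_right .
  have "(\<phi> has_vector_derivative 1) (at 0 within {0..})"
    using smooth_on_has_vector_derivative[OF smooth, of 0] unfolding deriv_0 by simp
  hence "((\<lambda>x. (\<phi> x - \<phi> 0) / (x - 0)) \<longlongrightarrow> 1) (at 0 within {0..})"
    unfolding has_real_derivative_iff_has_vector_derivative[symmetric] has_field_derivative_iff .
  thus "((\<lambda>x. \<phi> x / x) \<longlongrightarrow> 1) (at_right 0)"
    using \<open>expanding \<phi>\<close> unfolding at_within_Ici_at_right by (simp add: expanding_def)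
qed

lemma lower_jordan_block_mult_index:
  assumes "v \<in> carrier_vec M" "i < M"
  shows "(lower_jordan_block M l *\<^sub>v v) $ i = l * v $ i + (if i = 0 then 0 else v $ (i - 1))"
proof -
  have "(lower_jordan_block M l *\<^sub>v v) $ i =
      (\<Sum>j<M. (if j = i then l else if i = j + 1 then 1 else 0) * v $ j)"
    using assms by (simp add: lower_jordan_block_def scalar_prod_def lessThan_atLeast0 eq_commute[of i])
  also have "\<dots> = (\<Sum>j<M. (if j = i then l * v $ j else 0) + (if i = j + 1 then v $ j else 0))"
    by (intro sum.cong) auto
  also have "\<dots> = l * v $ i + (\<Sum>j<M. if i = j + 1 then v $ j else 0)"
    using assms by (simp add: sum.distrib)
  also have "(\<Sum>j<M. if i = j + 1 then v $ j else 0) = (if i = 0 then 0 else v $ (i - 1))"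
  proof (cases i)
    case (Suc k)
    have "(\<Sum>j<M. if i = j + 1 then v $ j else 0) = (\<Sum>j<M. if j = k then v $ j else 0)"
      using Suc by (intro sum.cong) auto
    with Suc assms show ?thesis by simp
  qed simp
  finally show ?thesis .
qed

context expansion_tangent_to_id
begin

lemma jet_bigo_homogeneous_solution:
  assumes "1 < cmod l" "smooth_on {0<..} \<beta>" "\<And>x. 0 < x \<Longrightarrow> \<beta> (\<phi> x) = l * \<beta> x"
  shows "jet_bigo N m \<beta>"
  by (rule jet_bigo_solution[of l \<beta> m "\<lambda>_. 1" N "\<lambda>_. 0"])
     (use assms jet_bigo_const jet_bigo_zero in auto)

text \<open>
  Induction on \<open>i\<close>: the first component solves the homogeneous equation, and each later one has its
  predecessor, which is already estimated, as inhomogeneity.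
\<close>

lemma jet_bigo_jordan_solution:
  fixes \<beta> :: "real \<Rightarrow> complex vec"
  assumes l: "1 < cmod l" and \<beta>: "\<beta> \<in> S_space M l \<phi>" and "i < M"
  shows "jet_bigo N m (\<lambda>x. \<beta> x $ i)"
proof -
  have smooth: "smooth_on {0<..} (\<lambda>x. \<beta> x $ k)" if "k < M" for k
    using \<beta> that by (simp add: S_space_def vec_smooth_on_def)
  have eq: "\<beta> (\<phi> x) $ k = l * \<beta> x $ k + (if k = 0 then 0 else \<beta> x $ (k - 1))"
    if "k < M" "0 < x" for k x
  proof -
    have "\<beta> x \<in> carrier_vec M" "\<beta> (\<phi> x) = lower_jordan_block M l *\<^sub>v \<beta> x"
      using \<beta> \<open>0 < x\<close> by (auto simp: S_space_def dest: PiE_mem)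
    thus ?thesis using lower_jordan_block_mult_index[of "\<beta> x" M k l] \<open>k < M\<close> by simp
  qed
  show ?thesis
    using \<open>i < M\<close>
  proof (induction i)
    case 0
    show ?case
      using eq[OF 0] by (intro jet_bigo_homogeneous_solution[OF l smooth[OF 0]]) simp
  next
    case (Suc i)
    show ?case
    proof (rule jet_bigo_solution[OF l smooth[OF Suc.prems] jet_bigo_const tendsto_const])
      show "jet_bigo N m (\<lambda>x. \<beta> x $ i)" using Suc by simp
      show "1 *\<^sub>R \<beta> (\<phi> x) $ Suc i = l * \<beta> x $ Suc i + \<beta> x $ i" if "0 < x" for x
        using eq[OF Suc.prems that] by simp
    qed
  qed
qed

end

section \<open>Solutions on the open and on the closed half-line\<close>

lemma K_space_eq_0_at_0:
  assumes "\<beta> \<in> K_space l \<phi>" "\<phi> 0 = 0" "l \<noteq> 1"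
  shows "\<beta> 0 = 0"
proof -
  have "\<beta> 0 = l * \<beta> 0" using assms by (force simp: K_space_def)
  hence "(1 - l) * \<beta> 0 = 0" by (simp add: algebra_simps)
  thus ?thesis using assms(3) by simp
qed

text \<open>
  The inverse of restriction is extension by \<open>0\<close>, because the functional equation at the fixed point
  \<open>0\<close> reads \<open>\<beta> 0 = l * \<beta> 0\<close> with \<open>l \<noteq> 1\<close> and leaves no other value.
\<close>

lemma bij_betw_K_space_Z_space:
  assumes "\<phi> 0 = 0" "\<And>x. 0 < x \<Longrightarrow> 0 < \<phi> x" "l \<noteq> 1"
    and extend: "\<And>\<beta>. \<beta> \<in> Z_space l \<phi> \<Longrightarrow> smooth_on {0..} (\<beta>(0 := 0))"
  shows "bij_betw (\<lambda>\<beta>. restrict \<beta> {0<..}) (K_space l \<phi>) (Z_space l \<phi>)"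
proof (rule bij_betw_byWitness[where f' = "\<lambda>\<beta>. \<beta>(0 := 0)"])
  show "\<forall>\<beta>\<in>K_space l \<phi>. (restrict \<beta> {0<..})(0 := 0) = \<beta>"
  proof
    fix \<beta> assume \<beta>: "\<beta> \<in> K_space l \<phi>"
    show "(restrict \<beta> {0<..})(0 := 0) = \<beta>"
    proof
      fix x show "((restrict \<beta> {0<..})(0 := 0)) x = \<beta> x"
        using \<beta> K_space_eq_0_at_0[OF \<beta> assms(1,3)]
        by (auto simp: K_space_def extensional_def)
    qed
  qed
  show "\<forall>\<beta>\<in>Z_space l \<phi>. restrict (\<beta>(0 := 0)) {0<..} = \<beta>"
  proof
    fix \<beta> assume \<beta>: "\<beta> \<in> Z_space l \<phi>"
    show "restrict (\<beta>(0 := 0)) {0<..} = \<beta>"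
      using \<beta> by (auto simp: Z_space_def extensional_def restrict_def fun_eq_iff)
  qed
  show "(\<lambda>\<beta>. restrict \<beta> {0<..}) ` K_space l \<phi> \<subseteq> Z_space l \<phi>"
  proof (rule image_subsetI)
    fix \<beta> assume \<beta>: "\<beta> \<in> K_space l \<phi>"
    hence "smooth_on {0<..} (restrict \<beta> {0<..})"
      by (intro smooth_on_open_subset[of "{0<..}" "{0..}" _ \<beta>]) (auto simp: K_space_def)
    thus "restrict \<beta> {0<..} \<in> Z_space l \<phi>"
      using \<beta> assms(2) by (simp add: K_space_def Z_space_def)
  qed
  show "(\<lambda>\<beta>. \<beta>(0 := 0)) ` Z_space l \<phi> \<subseteq> K_space l \<phi>"
  proof (rule image_subsetI)
    fix \<beta> assume \<beta>: "\<beta> \<in> Z_space l \<phi>"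
    have "(\<beta>(0 := 0)) (\<phi> x) = l * (\<beta>(0 := 0)) x" if "0 \<le> x" for x
      using \<beta> that assms(1) assms(2)[of x] by (cases "x = 0") (auto simp: Z_space_def)
    with \<beta> extend[OF \<beta>] show "\<beta>(0 := 0) \<in> K_space l \<phi>"
      by (auto simp: Z_space_def K_space_def extensional_def)
  qed
qed

theorem theorem5p2:
  fixes \<phi> :: "real \<Rightarrow> real" and l :: complex
  assumes "diffeo_halfline \<phi>" and "expanding \<phi>"
    and "case_2 \<phi> \<or> case_3 \<phi>"
    and "cmod l > 1"
  shows "(\<forall>\<beta>\<in>Z_space l \<phi>. \<exists>\<beta>'. (\<forall>x>0. \<beta>' x = \<beta> x) \<and> smooth_on {0..} \<beta>' \<and> flat_at_0 \<beta>') \<and>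
    bij_betw (\<lambda>\<beta>. restrict \<beta> {0<..}) (K_space l \<phi>) (Z_space l \<phi>) \<and>
    (\<forall>M\<ge>2. \<forall>\<beta>\<in>S_space M l \<phi>.
      vec_smooth_on M {0..} (\<beta>(0 := 0\<^sub>v M)) \<and> vec_flat_at_0 M (\<beta>(0 := 0\<^sub>v M)))"
proof -
  have "same_jet 1 \<phi> id"
    using assms(3)
  proof
    assume "case_2 \<phi>"
    then obtain n where "n \<ge> 2" "same_jet (n - 1) \<phi> id" by (auto simp: case_2_def)
    thus ?thesis by (auto simp: same_jet_def)
  qed (simp add: case_3_def)
  hence "vector_derivative \<phi> (at 0 within {0..}) = 1"
    by (rule same_jet_imp_deriv_0) simp
  then interpret expansion_tangent_to_id \<phi> "\<lambda>x. vector_derivative \<phi> (at x within {0..})"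
    using assms(1,2) by (intro expansion_tangent_to_id_if_smooth) (auto simp: diffeo_halfline_def)
  have extend: "smooth_on {0..} (\<beta>(0 := 0)) \<and> flat_at_0 (\<beta>(0 := 0))" if "\<beta> \<in> Z_space l \<phi>" for \<beta>
  proof (rule extension_by_zero_smooth_flat)
    have "jet_bigo 2 m \<beta>" for m
      using that assms(4) by (intro jet_bigo_homogeneous_solution) (auto simp: Z_space_def)
    thus "jet_bigo 2 m (\<beta>(0 := 0))" for m by (rule jet_bigo_cong) simp
  qed simp
  have extend_vec: "smooth_on {0..} (\<lambda>x. (\<beta>(0 := 0\<^sub>v M)) x $ i) \<and> flat_at_0 (\<lambda>x. (\<beta>(0 := 0\<^sub>v M)) x $ i)"
    if "\<beta> \<in> S_space M l \<phi>" "i < M" for M i \<beta>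
  proof (rule extension_by_zero_smooth_flat)
    show "jet_bigo 2 m (\<lambda>x. (\<beta>(0 := 0\<^sub>v M)) x $ i)" for m
      by (rule jet_bigo_cong[OF jet_bigo_jordan_solution[OF assms(4) that]]) simp
    show "(\<beta>(0 := 0\<^sub>v M)) 0 $ i = 0" using \<open>i < M\<close> by simp
  qed
  have "bij_betw (\<lambda>\<beta>. restrict \<beta> {0<..}) (K_space l \<phi>) (Z_space l \<phi>)"
  proof (rule bij_betw_K_space_Z_space)
    show "\<phi> 0 = 0" using assms(2) by (simp add: expanding_def)
    show "l \<noteq> 1" using assms(4) by auto
  qed (use extend positive in auto)
  moreover have "\<exists>\<beta>'. (\<forall>x>0. \<beta>' x = \<beta> x) \<and> smooth_on {0..} \<beta>' \<and> flat_at_0 \<beta>'"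
    if "\<beta> \<in> Z_space l \<phi>" for \<beta>
    using extend[OF that] by (intro exI[of _ "\<beta>(0 := 0)"]) simp
  ultimately show ?thesis
    using extend_vec by (simp add: vec_smooth_on_def vec_flat_at_0_def)
qed

end
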